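(* Let $\mathcal D$ be a directed acyclic graph with finite vertex set $V$, let $v_1<\cdots<v_n$ be a topological ordering of $\mathcal D$, put $V_j=\{v_1,\dots,v_j\}$, and let $\mathcal Q=\{Q_{v|\operatorname{pa}(v)}:v\in V\}$ be a family of quantum kernels for $\mathcal D$. Let $\omega=\Phi_{\mathcal D,<}(\mathcal Q)$ be obtained from the ordered kernel construction. Then, for $j=2,\dots,n$, $$\omega_{v_j|V_{j-1}}=Q_{v_j|\operatorname{pa}(v_j)},$$ where the kernel is embedded into the operators on $\mathcal H_{V_j}$ by tensoring with $I_{V_{j-1}\setminus\operatorname{pa}(v_j)}$.
   Context: For each $v\in V$, $\mathcal H_v$ is a finite-dimensional complex Hilbert space; $\mathcal H_A=\bigotimes_{v\in A}\mathcal H_v$ for $A\subseteq V$, with $\mathcal H_\varnothing=\mathbb C$. An operator on $\mathcal H_A$ used on a larger tensor product is understood to be tensored with the identity on the complementary factors. For positive definite $M,N$ on the same space, $M\star N:=N^{1/2}MN^{1/2}$. $\operatorname{pa}(v)$ is the set of parents of $v$. An ordering is topological if $u<w$ for every arrow $u\to w$. A family of quantum kernels for $\mathcal D$ assigns to every $v\in V$ a positive definite operator $Q_{v|\operatorname{pa}(v)}$ on $\mathcal H_{\{v\}\cup\operatorname{pa}(v)}$ with $\operatorname{Tr}_v(Q_{v|\operatorname{pa}(v)})=I_{\operatorname{pa}(v)}$ (for a root $v$, this is a positive definite density operator $Q_v$ on $\mathcal H_v$). The ordered kernel construction sets $\omega_{V_1}=Q_{v_1}$, $\omega_{V_j}=Q_{v_j|\operatorname{pa}(v_j)}\star\omega_{V_{j-1}}$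 for $j=2,\dots,n$ (on $\mathcal H_{V_j}$), and $\Phi_{\mathcal D,<}(\mathcal Q):=\omega_{V_n}$, a positive definite density operator on $\mathcal H_V$. In the conclusion, conditionals are computed from the final state $\omega$: $\omega_A=\operatorname{Tr}_{V\setminus A}(\omega)$ and, for disjoint $A,B\subseteq V$, $\omega_{A|B}:=\omega_B^{-1/2}\omega_{A\cup B}\omega_B^{-1/2}$. *)

theory Defs
  imports Complex_Main "HOL-Library.FuncSet"
begin

text \<open>
  The Hilbert space at a vertex \<open>v\<close> is presented by an orthonormal basis, labelled by a finite set
  \<open>B v\<close>. Then \<open>\<H>\<^sub>A\<close>, the tensor product over \<open>v \<in> A\<close>, has the product orthonormal basis labelled
  by \<open>cfg B A\<close>; for \<open>A = {}\<close> there is exactly one label, so the space is \<open>\<complex>\<close>. An operator on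
  \<open>\<H>\<^sub>A\<close> is its matrix in that basis, with value 0 outside \<open>cfg B A \<times> cfg B A\<close>, so that equality of
  operators is equality of functions. The finiteness of the sets \<open>B v\<close> is assumed where it is used.
\<close>

type_synonym ('v, 'b) oper = "('v \<Rightarrow> 'b) \<Rightarrow> ('v \<Rightarrow> 'b) \<Rightarrow> complex"

definition cfg :: "('v \<Rightarrow> 'b set) \<Rightarrow> 'v set \<Rightarrow> ('v \<Rightarrow> 'b) set" where
  "cfg B A = (\<Pi>\<^sub>E v\<in>A. B v)"

definition operators :: "('v \<Rightarrow> 'b set) \<Rightarrow> 'v set \<Rightarrow> ('v, 'b) oper set" where
  "operators B A = {M. \<forall>x y. \<not> (x \<in> cfg B A \<and> y \<in> cfg B A) \<longrightarrow> M x y = 0}"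

definition id_op :: "('v \<Rightarrow> 'b set) \<Rightarrow> 'v set \<Rightarrow> ('v, 'b) oper" where
  "id_op B A = (\<lambda>x y. if x \<in> cfg B A \<and> y \<in> cfg B A \<and> x = y then 1 else 0)"

definition mult_op ::
    "('v \<Rightarrow> 'b set) \<Rightarrow> 'v set \<Rightarrow> ('v, 'b) oper \<Rightarrow> ('v, 'b) oper \<Rightarrow> ('v, 'b) oper" where
  "mult_op B A M N = (\<lambda>x z. if x \<in> cfg B A \<and> z \<in> cfg B A
     then (\<Sum>y\<in>cfg B A. M x y * N y z) else 0)"

definition pos_def :: "('v \<Rightarrow> 'b set) \<Rightarrow> 'v set \<Rightarrow> ('v, 'b) oper \<Rightarrow> bool" where
  "pos_def B A M \<longleftrightarrow> M \<in> operators B A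
     \<and> (\<forall>x\<in>cfg B A. \<forall>y\<in>cfg B A. M y x = cnj (M x y))
     \<and> (\<forall>\<psi>. (\<exists>x\<in>cfg B A. \<psi> x \<noteq> 0) \<longrightarrow>
          0 < Re (\<Sum>x\<in>cfg B A. \<Sum>y\<in>cfg B A. cnj (\<psi> x) * M x y * \<psi> y))"

text \<open>The two descriptions below are only meant for positive definite \<open>N\<close> and invertible \<open>M\<close>,
  respectively; there they pick out the unique such operator.\<close>

definition sqrt_op :: "('v \<Rightarrow> 'b set) \<Rightarrow> 'v set \<Rightarrow> ('v, 'b) oper \<Rightarrow> ('v, 'b) oper" where
  "sqrt_op B A N = (THE R. pos_def B A R \<and> mult_op B A R R = N)"

definition inv_op :: "('v \<Rightarrow> 'b set) \<Rightarrow> 'v set \<Rightarrow> ('v, 'b) oper \<Rightarrow> ('v, 'b) oper" where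
  "inv_op B A M = (THE R. R \<in> operators B A
     \<and> mult_op B A R M = id_op B A \<and> mult_op B A M R = id_op B A)"

definition star_op ::
    "('v \<Rightarrow> 'b set) \<Rightarrow> 'v set \<Rightarrow> ('v, 'b) oper \<Rightarrow> ('v, 'b) oper \<Rightarrow> ('v, 'b) oper" where
  "star_op B A M N = mult_op B A (mult_op B A (sqrt_op B A N) M) (sqrt_op B A N)"

text \<open>For \<open>A \<subseteq> S\<close> and \<open>M\<close> an operator on \<open>\<H>\<^sub>A\<close>, this is \<open>M\<close> tensored with the identity on the
  factors in \<open>S - A\<close>, an operator on \<open>\<H>\<^sub>S\<close>.\<close>

definition embed_op ::
    "('v \<Rightarrow> 'b set) \<Rightarrow> 'v set \<Rightarrow> 'v set \<Rightarrow> ('v, 'b) oper \<Rightarrow> ('v, 'b) oper" where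
  "embed_op B A S M = (\<lambda>x y. if x \<in> cfg B S \<and> y \<in> cfg B S \<and> (\<forall>v\<in>S - A. x v = y v)
     then M (restrict x A) (restrict y A) else 0)"

text \<open>For \<open>C \<subseteq> S\<close> and \<open>M\<close> an operator on \<open>\<H>\<^sub>S\<close>, this is \<open>Tr\<^sub>C(M)\<close>, an operator on the space of
  the remaining factors \<open>S - C\<close>.\<close>

definition ptrace ::
    "('v \<Rightarrow> 'b set) \<Rightarrow> 'v set \<Rightarrow> 'v set \<Rightarrow> ('v, 'b) oper \<Rightarrow> ('v, 'b) oper" where
  "ptrace B S C M = (\<lambda>x y. if x \<in> cfg B (S - C) \<and> y \<in> cfg B (S - C)
     then (\<Sum>z\<in>cfg B C. M (override_on z x (S - C)) (override_on z y (S - C))) else 0)"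

definition marginal ::
    "('v \<Rightarrow> 'b set) \<Rightarrow> 'v set \<Rightarrow> ('v, 'b) oper \<Rightarrow> 'v set \<Rightarrow> ('v, 'b) oper" where
  "marginal B V \<omega> A = ptrace B V (V - A) \<omega>"

text \<open>\<open>\<omega>\<^bsub>A|C\<^esub>\<close> for disjoint \<open>A, C \<subseteq> V\<close>, an operator on the space for \<open>A \<union> C\<close>.\<close>

definition conditional ::
    "('v \<Rightarrow> 'b set) \<Rightarrow> 'v set \<Rightarrow> ('v, 'b) oper \<Rightarrow> 'v set \<Rightarrow> 'v set \<Rightarrow> ('v, 'b) oper" where
  "conditional B V \<omega> A C =
     (let K = embed_op B C (A \<union> C) (inv_op B C (sqrt_op B C (marginal B V \<omega> C)))
      in mult_op B (A \<union> C) (mult_op B (A \<union> C) K (marginal B V \<omega> (A \<union> C))) K)"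

definition dag :: "'v set \<Rightarrow> ('v \<times> 'v) set \<Rightarrow> bool" where
  "dag V E \<longleftrightarrow> finite V \<and> E \<subseteq> V \<times> V \<and> acyclic E"

definition parents :: "('v \<times> 'v) set \<Rightarrow> 'v \<Rightarrow> 'v set" where
  "parents E v = {u. (u, v) \<in> E}"

text \<open>The ordering is given by its increasing enumeration \<open>vs 1, \<dots>, vs n\<close>; values of \<open>vs\<close> outside
  \<open>{1..n}\<close> are irrelevant.\<close>

definition topological_ordering ::
    "'v set \<Rightarrow> ('v \<times> 'v) set \<Rightarrow> nat \<Rightarrow> (nat \<Rightarrow> 'v) \<Rightarrow> bool" where
  "topological_ordering V E n vs \<longleftrightarrow> bij_betw vs {1..n} V
     \<and> (\<forall>i\<in>{1..n}. \<forall>j\<in>{1..n}. (vs i, vs j) \<in> E \<longrightarrow> i < j)"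

definition prefix_set :: "(nat \<Rightarrow> 'v) \<Rightarrow> nat \<Rightarrow> 'v set" where
  "prefix_set vs j = vs ` {1..j}"

text \<open>\<open>Q v\<close> stands for the kernel of \<open>v\<close> given \<open>parents E v\<close>. For a root \<open>v\<close> the trace condition
  is an equation between operators on \<open>\<complex>\<close> and says that \<open>Q v\<close> has trace 1.\<close>

definition quantum_kernels ::
    "('v \<Rightarrow> 'b set) \<Rightarrow> 'v set \<Rightarrow> ('v \<times> 'v) set \<Rightarrow> ('v \<Rightarrow> ('v, 'b) oper) \<Rightarrow> bool" where
  "quantum_kernels B V E Q \<longleftrightarrow> (\<forall>v\<in>V.
     pos_def B ({v} \<union> parents E v) (Q v)
     \<and> ptrace B ({v} \<union> parents E v) {v} (Q v) = id_op B (parents E v))"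

text \<open>\<open>kernel_state B E vs Q j\<close> is the state on the first \<open>j\<close> vertices. The value at 0 is a
  convention (the only density operator on \<open>\<complex>\<close>), relevant only for the empty graph.\<close>

fun kernel_state ::
    "('v \<Rightarrow> 'b set) \<Rightarrow> ('v \<times> 'v) set \<Rightarrow> (nat \<Rightarrow> 'v) \<Rightarrow> ('v \<Rightarrow> ('v, 'b) oper) \<Rightarrow> nat \<Rightarrow> ('v, 'b) oper"
where
  "kernel_state B E vs Q 0 = id_op B {}"
| "kernel_state B E vs Q (Suc 0) = Q (vs 1)"
| "kernel_state B E vs Q (Suc (Suc j)) =
     (let v = vs (Suc (Suc j)); S = prefix_set vs (Suc (Suc j))
      in star_op B S
           (embed_op B ({v} \<union> parents E v) S (Q v))
           (embed_op B (prefix_set vs (Suc j)) S (kernel_state B E vs Q (Suc j))))"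

text \<open>\<open>\<Phi>\<^bsub>\<D>,<\<^esub>(\<Q>)\<close>, where \<open>n\<close> is the number of vertices.\<close>

definition ordered_construction ::
    "('v \<Rightarrow> 'b set) \<Rightarrow> ('v \<times> 'v) set \<Rightarrow> nat \<Rightarrow> (nat \<Rightarrow> 'v) \<Rightarrow> ('v \<Rightarrow> ('v, 'b) oper) \<Rightarrow> ('v, 'b) oper"
where
  "ordered_construction B E n vs Q = kernel_state B E vs Q n"

end

theory Submission
  imports Defs "HOL-Computational_Algebra.Fundamental_Theorem_Algebra"
begin

text \<open>
  Write \<open>\<omega>\<^sub>j = R Q R\<close> with \<open>R\<^sup>2 = \<omega>\<^bsub>j-1\<^esub> \<otimes> I\<close>. Since \<open>R\<close> itself has the form
  \<open>\<omega>\<^bsub>j-1\<^esub>\<^sup>1\<^sup>/\<^sup>2 \<otimes> I\<close>, it can be pulled out of the partial trace over \<open>v\<^sub>j\<close>, and the normalisation of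
  the kernel leaves \<open>\<omega>\<^bsub>j-1\<^esub>\<close>. Hence the marginal of the final state on \<open>V\<^sub>j\<close> is \<open>\<omega>\<^sub>j\<close>, and conjugating
  it with \<open>R\<inverse>\<close> returns \<open>Q\<close>.

  Square roots and inverses of a positive definite \<open>N\<close> are polynomials in \<open>N\<close>: an annihilating
  polynomial of least degree has simple positive roots, so the value of \<open>p(N)\<close> only depends on the
  values of \<open>p\<close> at these roots, which can be interpolated.
\<close>


subsection \<open>Polynomials in an operator\<close>

definition adj_op :: "('v, 'b) oper \<Rightarrow> ('v, 'b) oper" where
  "adj_op M = (\<lambda>x y. cnj (M y x))"

definition scale_op :: "complex \<Rightarrow> ('v, 'b) oper \<Rightarrow> ('v, 'b) oper" where
  "scale_op c M = (\<lambda>x y. c * M x y)"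

definition zero_op :: "('v, 'b) oper" where
  "zero_op = (\<lambda>x y. 0)"

definition add_op :: "('v, 'b) oper \<Rightarrow> ('v, 'b) oper \<Rightarrow> ('v, 'b) oper" where
  "add_op M N = (\<lambda>x y. M x y + N x y)"

text \<open>Horner evaluation, with a constant \<open>a\<close> read as \<open>a\<close> times the
  identity.\<close>

definition poly_op ::
    "('v \<Rightarrow> 'b set) \<Rightarrow> 'v set \<Rightarrow> ('v, 'b) oper \<Rightarrow> complex poly \<Rightarrow> ('v, 'b) oper" where
  "poly_op B A N p = fold_coeffs (\<lambda>a R. add_op (scale_op a (id_op B A)) (mult_op B A N R)) p zero_op"

lemma mult_op_in [simp]: "mult_op B A M N \<in> operators B A"
  by (simp add: operators_def mult_op_def)

lemma id_op_in [simp]: "id_op B A \<in> operators B A"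
  by (simp add: operators_def id_op_def)

lemma zero_op_in [simp]: "zero_op \<in> operators B A"
  by (simp add: operators_def zero_op_def)

lemma add_op_in [simp]:
  "M \<in> operators B A \<Longrightarrow> N \<in> operators B A \<Longrightarrow> add_op M N \<in> operators B A"
  by (simp add: operators_def add_op_def)

lemma scale_op_in [simp]: "M \<in> operators B A \<Longrightarrow> scale_op c M \<in> operators B A"
  by (simp add: operators_def scale_op_def)

lemma adj_op_in [simp]: "M \<in> operators B A \<Longrightarrow> adj_op M \<in> operators B A"
  by (auto simp: operators_def adj_op_def)

lemma operators_eqI:
  assumes "M \<in> operators B A" "N \<in> operators B A"
    and "\<And>x y. x \<in> cfg B A \<Longrightarrow> y \<in> cfg B A \<Longrightarrow> M x y = N x y"
  shows "M = N"
proof (intro ext)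
  fix x y
  show "M x y = N x y"
    using assms by (cases "x \<in> cfg B A \<and> y \<in> cfg B A") (auto simp: operators_def)
qed

lemma add_op_ac:
  "add_op (add_op L M) N = add_op L (add_op M N)"
  "add_op M N = add_op N M"
  "add_op L (add_op M N) = add_op M (add_op L N)"
  by (simp_all add: add_op_def fun_eq_iff)

lemma add_op_zero [simp]: "add_op zero_op M = M" "add_op M zero_op = M"
  by (simp_all add: add_op_def zero_op_def)

lemma scale_op_simps [simp]:
  "scale_op 0 M = zero_op" "scale_op 1 M = M" "scale_op c zero_op = zero_op"
  "scale_op c (add_op M N) = add_op (scale_op c M) (scale_op c N)"
  "scale_op (c + d) M = add_op (scale_op c M) (scale_op d M)"
  "scale_op c (scale_op d M) = scale_op (c * d) M"
  by (simp_all add: scale_op_def add_op_def zero_op_def fun_eq_iff algebra_simps)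

lemma adj_op_simps [simp]:
  "adj_op zero_op = zero_op" "adj_op (add_op M N) = add_op (adj_op M) (adj_op N)"
  "adj_op (scale_op c M) = scale_op (cnj c) (adj_op M)"
  "adj_op (id_op B A) = id_op B A" "adj_op (adj_op M) = M"
  by (auto simp: adj_op_def add_op_def zero_op_def fun_eq_iff scale_op_def id_op_def)

lemma adj_op_mult [simp]: "adj_op (mult_op B A M N) = mult_op B A (adj_op N) (adj_op M)"
  by (simp add: adj_op_def fun_eq_iff mult_op_def mult.commute)

lemma mult_op_linear [simp]:
  "mult_op B A zero_op M = zero_op" "mult_op B A M zero_op = zero_op"
  "mult_op B A (add_op L M) N = add_op (mult_op B A L N) (mult_op B A M N)"
  "mult_op B A N (add_op L M) = add_op (mult_op B A N L) (mult_op B A N M)"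
  "mult_op B A (scale_op c M) N = scale_op c (mult_op B A M N)"
  "mult_op B A M (scale_op c N) = scale_op c (mult_op B A M N)"
  by (simp_all add: mult_op_def fun_eq_iff scale_op_def add_op_def zero_op_def
      distrib_left distrib_right sum.distrib sum_distrib_left mult.assoc mult.left_commute)

lemma poly_op_0 [simp]: "poly_op B A N 0 = zero_op"
  by (simp add: poly_op_def)

text \<open>\<open>fold_coeffs\<close> skips a step only for \<open>a = 0\<close> and
  \<open>p = 0\<close>, and there both sides are \<open>zero_op\<close>.\<close>

lemma poly_op_pCons:
  "poly_op B A N (pCons a p) = add_op (scale_op a (id_op B A)) (mult_op B A N (poly_op B A N p))"
  by (cases "p = 0"; cases "a = 0") (simp_all add: poly_op_def)

lemma poly_op_in [simp]: "poly_op B A N p \<in> operators B A"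
  by (cases p) (simp add: poly_op_pCons)

lemma poly_op_add: "poly_op B A N (p + q) = add_op (poly_op B A N p) (poly_op B A N q)"
  by (induction p q rule: poly_induct2) (simp_all add: poly_op_pCons add_op_ac)

lemma poly_op_smult: "poly_op B A N (smult c p) = scale_op c (poly_op B A N p)"
  by (induction p) (simp_all add: poly_op_pCons)

section \<open>Real interpolation on a finite set of nodes\<close>

lemma interpolating_poly_exists:
  fixes f :: "real \<Rightarrow> real"
  assumes "finite X"
  shows "\<exists>q. \<forall>x\<in>X. poly q x = f x"
  using assms
proof induction
  case (insert a X)
  then obtain q where q: "\<forall>x\<in>X. poly q x = f x" by blast
  \<comment> \<open>\<open>w\<close> vanishes on the old nodes and not at \<open>a\<close>, so
    adding a multiple of it corrects the value at \<open>a\<close> alone.\<close>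
  define w where "w = (\<Prod>x\<in>X. [:-x, 1:])"
  have "poly w x = 0" if "x \<in> X" for x
    using that insert.hyps by (auto simp: w_def poly_prod prod_zero_iff)
  moreover have "poly w a \<noteq> 0"
    using insert.hyps by (auto simp: w_def poly_prod prod_zero_iff)
  ultimately show ?case
    using q by (intro exI[of _ "q + smult ((f a - poly q a) / poly w a) w"]) auto
qed simp

lemma poly_map_of_real: "poly (map_poly of_real q) (of_real x) = of_real (poly q x)"
  by (induction q) (simp_all add: map_poly_pCons)

context
  fixes B :: "'v \<Rightarrow> 'b set" and A :: "'v set"
  assumes fin: "finite (cfg B A)"
begin

abbreviation op_times (infixl "\<cdot>" 70) where "M \<cdot> N \<equiv> mult_op B A M N"

lemma mult_op_assoc: "L \<cdot> M \<cdot> N = L \<cdot> (M \<cdot> N)"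
proof -
  have "(\<Sum>y\<in>cfg B A. (\<Sum>w\<in>cfg B A. L x w * M w y) * N y z)
      = (\<Sum>w\<in>cfg B A. L x w * (\<Sum>y\<in>cfg B A. M w y * N y z))" for x z
    unfolding sum_distrib_left sum_distrib_right mult.assoc by (rule sum.swap)
  then show ?thesis
    by (simp add: mult_op_def fun_eq_iff cong: sum.cong)
qed

lemma mult_op_id [simp]:
  assumes "M \<in> operators B A"
  shows "id_op B A \<cdot> M = M" "M \<cdot> id_op B A = M"
  by (rule operators_eqI[OF mult_op_in assms],
      simp add: fin mult_op_def id_op_def if_distrib[where f = "\<lambda>a. a * _"]
        if_distrib[where f = "(*) _"] cong: if_cong)+

lemma poly_op_mult: "poly_op B A N (p * q) = poly_op B A N p \<cdot> poly_op B A N q"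
  by (induction p) (simp_all add: poly_op_pCons poly_op_add poly_op_smult mult_op_assoc)

lemma poly_op_1: "poly_op B A N 1 = id_op B A"
  by (simp add: one_pCons poly_op_pCons)

lemma poly_op_X:
  assumes "N \<in> operators B A"
  shows "poly_op B A N [:0, 1:] = N"
  using assms by (simp add: poly_op_pCons)

text \<open>Conjugation fixes real coefficients, and the reversal of products by the adjoint is
  harmless because \<open>N\<close> commutes with every polynomial in \<open>N\<close>.\<close>

lemma adj_poly_op_real:
  assumes "N \<in> operators B A" "adj_op N = N"
  shows "adj_op (poly_op B A N (map_poly of_real p)) = poly_op B A N (map_poly of_real p)"
proof (induction p)
  case (pCons a p)
  let ?P = "poly_op B A N (map_poly of_real p)"
  have "?P \<cdot> N = N \<cdot> ?P"
    by (metis poly_op_X[OF assms(1)] poly_op_mult mult.commute)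
  then show ?case using pCons assms by (simp add: map_poly_pCons poly_op_pCons)
qed simp

subsection \<open>Positive definite operators\<close>

lemma gram_entry:
  "x \<in> cfg B A \<Longrightarrow> (adj_op T \<cdot> T) x x = of_real (\<Sum>y\<in>cfg B A. (cmod (T y x))\<^sup>2)"
  by (simp add: mult_op_def adj_op_def complex_norm_square mult.commute del: of_real_power)

text \<open>The diagonal of \<open>adj_op T \<cdot> T\<close> holds the squared norms of the columns
  of \<open>T\<close>.\<close>

lemma gram_eq_0:
  assumes "T \<in> operators B A" "\<And>x. x \<in> cfg B A \<Longrightarrow> (adj_op T \<cdot> T) x x = 0"
  shows "T = zero_op"
proof (rule operators_eqI[OF assms(1)])
  fix y x assume xy: "y \<in> cfg B A" "x \<in> cfg B A"
  have "(\<Sum>y\<in>cfg B A. (cmod (T y x))\<^sup>2) = 0"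
    using assms(2)[OF xy(2)] gram_entry[OF xy(2)] by (metis of_real_eq_0_iff)
  then show "T y x = zero_op y x"
    using fin xy by (simp add: sum_nonneg_eq_0_iff zero_op_def)
qed simp

lemma pos_def_hermitian: "pos_def B A M \<Longrightarrow> adj_op M = M"
proof (rule operators_eqI[of _ B A])
  assume M: "pos_def B A M"
  then show "adj_op M \<in> operators B A" "M \<in> operators B A"
    by (simp_all add: pos_def_def)
  show "adj_op M x y = M x y" if "x \<in> cfg B A" "y \<in> cfg B A" for x y
    unfolding adj_op_def using M that unfolding pos_def_def by (metis (no_types))
qed

lemma pos_def_in [simp]: "pos_def B A M \<Longrightarrow> M \<in> operators B A"
  by (simp add: pos_def_def)

lemma conj_form_entry:
  assumes "x \<in> cfg B A"
  shows "(adj_op T \<cdot> M \<cdot> T) x x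
      = (\<Sum>y\<in>cfg B A. \<Sum>z\<in>cfg B A. cnj (T y x) * M y z * T z x)"
  using assms by (subst mult_op_assoc)
    (simp add: mult_op_def adj_op_def sum_distrib_left mult.assoc cong: sum.cong)

text \<open>The entry is the quadratic form of \<open>M\<close> at column \<open>x\<close> of
  \<open>T\<close>, so positivity can be used inside the operator algebra, without vectors.\<close>

lemma pos_def_conj_entry:
  assumes "pos_def B A M" "x \<in> cfg B A"
  shows "Im ((adj_op T \<cdot> M \<cdot> T) x x) = 0" "0 \<le> Re ((adj_op T \<cdot> M \<cdot> T) x x)"
    and "Re ((adj_op T \<cdot> M \<cdot> T) x x) = 0 \<Longrightarrow> y \<in> cfg B A \<Longrightarrow> T y x = 0"
proof -
  let ?r = "(adj_op T \<cdot> M \<cdot> T) x x"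
  have "adj_op (adj_op T \<cdot> M \<cdot> T) = adj_op T \<cdot> M \<cdot> T"
    using pos_def_hermitian[OF assms(1)] by (simp add: mult_op_assoc)
  then have "cnj ?r = ?r" by (metis adj_op_def)
  then show "Im ?r = 0" by (simp add: complex_eq_iff)
  have *: "0 < Re ?r" if "\<exists>y\<in>cfg B A. T y x \<noteq> 0"
    unfolding conj_form_entry[OF assms(2)]
    using assms(1)[unfolded pos_def_def, THEN conjunct2, THEN conjunct2, rule_format, of "\<lambda>y. T y x"]
      that by simp
  show "0 \<le> Re ?r"
  proof (cases "\<exists>y\<in>cfg B A. T y x \<noteq> 0")
    case False
    then have "?r = 0" by (simp add: conj_form_entry[OF assms(2)])
    then show ?thesis by simp
  qed (use * in simp)
  show "T y x = 0" if "Re ?r = 0" "y \<in> cfg B A"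
    using * that by force
qed

text \<open>The quadratic form at \<open>\<psi>\<close> is the squared norm of \<open>T\<close>
  applied to \<open>\<psi>\<close>, and the left inverse \<open>L\<close> makes \<open>T\<close>
  injective.\<close>

lemma pos_def_gram:
  assumes T: "T \<in> operators B A" and inv: "L \<cdot> T = id_op B A"
  shows "pos_def B A (adj_op T \<cdot> T)"
  unfolding pos_def_def
proof (intro conjI ballI allI impI)
  fix x y
  show "(adj_op T \<cdot> T) y x = cnj ((adj_op T \<cdot> T) x y)"
    by (metis adj_op_def adj_op_mult adj_op_simps(5))
next
  fix \<psi> :: "('v \<Rightarrow> 'b) \<Rightarrow> complex" assume "\<exists>x\<in>cfg B A. \<psi> x \<noteq> 0"
  then obtain x0 where x0: "x0 \<in> cfg B A" "\<psi> x0 \<noteq> 0" by auto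
  define \<phi> where "\<phi> z = (\<Sum>y\<in>cfg B A. T z y * \<psi> y)" for z
  have n: "of_real ((cmod w)\<^sup>2) = cnj w * w" for w
    by (metis complex_norm_square mult.commute)
  have "(\<Sum>x\<in>cfg B A. \<Sum>y\<in>cfg B A. cnj (\<psi> x) * (adj_op T \<cdot> T) x y * \<psi> y)
      = (\<Sum>x\<in>cfg B A. \<Sum>y\<in>cfg B A. \<Sum>z\<in>cfg B A. cnj (T z x * \<psi> x) * (T z y * \<psi> y))"
    by (simp add: mult_op_def adj_op_def sum_distrib_left sum_distrib_right ac_simps)
  also have "\<dots> = (\<Sum>x\<in>cfg B A. \<Sum>z\<in>cfg B A. \<Sum>y\<in>cfg B A. cnj (T z x * \<psi> x) * (T z y * \<psi> y))"
    by (intro sum.cong refl sum.swap)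
  also have "\<dots> = (\<Sum>z\<in>cfg B A. \<Sum>x\<in>cfg B A. \<Sum>y\<in>cfg B A. cnj (T z x * \<psi> x) * (T z y * \<psi> y))"
    by (rule sum.swap)
  also have "\<dots> = of_real (\<Sum>z\<in>cfg B A. (cmod (\<phi> z))\<^sup>2)"
    unfolding of_real_sum n \<phi>_def cnj_sum sum_product ..
  finally have eq: "Re (\<Sum>x\<in>cfg B A. \<Sum>y\<in>cfg B A. cnj (\<psi> x) * (adj_op T \<cdot> T) x y * \<psi> y)
      = (\<Sum>z\<in>cfg B A. (cmod (\<phi> z))\<^sup>2)" by simp
  have "\<exists>z\<in>cfg B A. \<phi> z \<noteq> 0"
  proof (rule ccontr)
    assume c: "\<not> ?thesis"
    \<comment> \<open>Applying \<open>L\<close> to \<open>\<phi>\<close> recovers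
      \<open>\<psi>\<close>, so \<open>\<phi> = 0\<close> would force
      \<open>\<psi> x0 = 0\<close>.\<close>
    have "\<psi> x0 = (\<Sum>y\<in>cfg B A. (L \<cdot> T) x0 y * \<psi> y)"
      using x0 fin by (simp add: inv id_op_def if_distrib[where f = "\<lambda>a. a * _"] cong: if_cong)
    also have "\<dots> = (\<Sum>z\<in>cfg B A. L x0 z * \<phi> z)"
      using x0 unfolding \<phi>_def sum_distrib_left
      by (subst sum.swap) (simp add: mult_op_def sum_distrib_right mult.assoc cong: sum.cong)
    finally show False using c x0 by simp
  qed
  then show "0 < Re (\<Sum>x\<in>cfg B A. \<Sum>y\<in>cfg B A. cnj (\<psi> x) * (adj_op T \<cdot> T) x y * \<psi> y)"
    unfolding eq by (auto intro!: sum_pos2[OF fin])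
qed simp

text \<open>Two polynomials of different degrees that vanish on the entries \<open>J\<close> have a nonzero combination
  that vanishes on one more entry.\<close>

lemma annihilating_poly_exists: "\<exists>p. p \<noteq> 0 \<and> poly_op B A N p = zero_op"
proof -
  \<comment> \<open>The bound \<open>m\<close> is arbitrary, so the induction hypothesis yields
    first \<open>p\<close> and then \<open>q\<close> of larger degree. In the end
    \<open>m = 0\<close> guarantees a nonzero polynomial.\<close>
  have "\<exists>p. m < degree p \<and> (\<forall>(x, y)\<in>J. poly_op B A N p x y = 0)"
    if "finite J" for J :: "(('v \<Rightarrow> 'b) \<times> ('v \<Rightarrow> 'b)) set" and m
    using that
  proof (induction arbitrary: m)
    case empty
    show ?case by (rule exI[of _ "monom 1 (Suc m)"]) (simp add: degree_monom_eq)
  next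
    case (insert j J)
    obtain x y where j: "j = (x, y)" by force
    obtain p where p: "m < degree p" "\<forall>(x, y)\<in>J. poly_op B A N p x y = 0"
      using insert.IH by blast
    obtain q where q: "degree p < degree q" "\<forall>(x, y)\<in>J. poly_op B A N q x y = 0"
      using insert.IH by blast
    show ?case
    proof (cases "poly_op B A N p x y = 0")
      case True
      then show ?thesis using p j by (intro exI[of _ p]) auto
    next
      case False
      let ?r = "smult (poly_op B A N p x y) q + smult (- poly_op B A N q x y) p"
      have "degree ?r = degree q"
        using False q(1) by (subst degree_add_eq_left) auto
      moreover have "\<forall>(x, y)\<in>insert j J. poly_op B A N ?r x y = 0"
        using bspec[OF p(2)] bspec[OF q(2)] unfolding poly_op_add poly_op_smult j
        by (force simp: add_op_def scale_op_def)
      ultimately show ?thesis using p(1) q(1) by (intro exI[of _ ?r]) auto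
    qed
  qed
  from this[of "cfg B A \<times> cfg B A" 0] fin
  obtain p where p: "0 < degree p" "\<forall>(x, y)\<in>cfg B A \<times> cfg B A. poly_op B A N p x y = 0" by auto
  then have "poly_op B A N p = zero_op"
    by (intro operators_eqI[OF poly_op_in zero_op_in]) (auto simp: zero_op_def)
  with p(1) show ?thesis by (intro exI[of _ p]) auto
qed

text \<open>\<open>G\<close> stands in for an eigenvector: a diagonal entry of
  \<open>adj_op G \<cdot> N \<cdot> G\<close> is \<open>z\<close> times the squared norm of a column
  of \<open>G\<close>, and it is real and positive when the column is nonzero.\<close>

lemma eigenvalue_pos:
  assumes N: "pos_def B A N" and G: "G \<in> operators B A" "G \<noteq> zero_op"
    and eig: "N \<cdot> G = scale_op z G"
  shows "\<exists>l>0. z = complex_of_real l"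
proof -
  obtain x y where xy: "x \<in> cfg B A" "y \<in> cfg B A" "G y x \<noteq> 0"
    using G operators_eqI[OF G(1) zero_op_in] by (auto simp: zero_op_def)
  define r where "r = (\<Sum>y\<in>cfg B A. (cmod (G y x))\<^sup>2)"
  have r: "0 < r"
    unfolding r_def using xy by (intro sum_pos2[OF fin, of y]) auto
  have e: "(adj_op G \<cdot> N \<cdot> G) x x = z * of_real r"
    using gram_entry[OF xy(1), of G] by (simp add: mult_op_assoc eig r_def) (simp add: scale_op_def)
  have "Im z * r = 0" "0 \<le> Re z * r" "Re z * r \<noteq> 0"
    using pos_def_conj_entry[OF N xy(1), of G] xy(2,3) unfolding e by auto
  with r show ?thesis
    by (intro exI[of _ "Re z"]) (auto simp: complex_eq_iff zero_le_mult_iff)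
qed

text \<open>The Gram operator of \<open>T \<cdot> H\<close> contains the factor
  \<open>T \<cdot> (T \<cdot> H)\<close>, hence vanishes. This excludes double roots of an
  annihilating polynomial of least degree.\<close>

lemma hermitian_square_cancel:
  assumes "T \<in> operators B A" "adj_op T = T" "T \<cdot> (T \<cdot> H) = zero_op"
  shows "T \<cdot> H = zero_op"
proof (rule gram_eq_0)
  have "adj_op (T \<cdot> H) \<cdot> (T \<cdot> H) = adj_op H \<cdot> (T \<cdot> (T \<cdot> H))"
    using assms(2) by (simp add: mult_op_assoc)
  then show "(adj_op (T \<cdot> H) \<cdot> (T \<cdot> H)) x x = 0" for x
    by (simp add: assms(3)) (simp add: zero_op_def)
qed simp

section \<open>The spectrum and the polynomial calculus on it\<close>

lemma poly_op_linear_factor: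
  "N \<in> operators B A \<Longrightarrow> poly_op B A N [:c, 1:] = add_op (scale_op c (id_op B A)) N"
  by (simp add: poly_op_pCons)

text \<open>This replaces diagonalisation: since agreement on \<open>L\<close> gives equal
  operators, functions of \<open>N\<close> can be obtained by interpolation on
  \<open>L\<close>.\<close>

lemma spectrum_exists:
  assumes N: "pos_def B A N"
  obtains L :: "real set" where "finite L" "\<And>l. l \<in> L \<Longrightarrow> 0 < l"
    and "\<And>p q. (\<And>l. l \<in> L \<Longrightarrow> poly p (of_real l) = poly q (of_real l))
      \<Longrightarrow> poly_op B A N p = poly_op B A N q"
proof -
  note Nin = pos_def_in[OF N]
  obtain p where p: "p \<noteq> 0" "poly_op B A N p = zero_op"
    and min: "\<And>q. q \<noteq> 0 \<Longrightarrow> poly_op B A N q = zero_op \<Longrightarrow> degree p \<le> degree q"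
    using annihilating_poly_exists[of N] ex_has_least_nat[of "\<lambda>p. p \<noteq> 0 \<and> poly_op B A N p = zero_op" _ degree]
    by metis
  \<comment> \<open>By minimality, \<open>p\<close> with one linear factor removed no longer
    annihilates \<open>N\<close>.\<close>
  have factor: "poly_op B A N g \<noteq> zero_op" if "p = [:-z, 1:] * g" for z g
  proof
    assume "poly_op B A N g = zero_op"
    moreover have "g \<noteq> 0" using p(1) that by auto
    ultimately have "degree p \<le> degree g" by (rule min[rotated])
    moreover have "degree p = Suc (degree g)"
      unfolding that using \<open>g \<noteq> 0\<close> by (subst degree_mult_eq) auto
    ultimately show False by simp
  qed
  have root: "\<exists>l>0. z = complex_of_real l" if "poly p z = 0" for z
  proof -
    obtain g where g: "p = [:-z, 1:] * g"
      using \<open>poly p z = 0\<close> unfolding poly_eq_0_iff_dvd by (elim dvdE)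
    let ?G = "poly_op B A N g"
    \<comment> \<open>\<open>p(N) = 0\<close> splits as \<open>(N - z) g(N) = 0\<close>, so the
      nonzero operator \<open>?G\<close> consists of eigenvectors for \<open>z\<close> and zero
      columns.\<close>
    have 0: "add_op (scale_op (-z) ?G) (N \<cdot> ?G) = zero_op"
      using p(2) Nin unfolding g poly_op_mult poly_op_linear_factor[OF Nin] by simp
    have "N \<cdot> ?G = scale_op z ?G"
      using 0 by (simp add: fun_eq_iff add_op_def scale_op_def zero_op_def)
    then show ?thesis
      by (rule eigenvalue_pos[OF N poly_op_in factor[OF g]])
  qed
  \<comment> \<open>A double root \<open>z\<close> is real, so \<open>N - z\<close> is Hermitian and
    one of its two occurrences in \<open>p(N) = 0\<close> can be cancelled, against
    minimality.\<close>
  have "order z p \<le> 1" for z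
  proof (rule ccontr)
    assume "\<not> order z p \<le> 1"
    then have "[:-z, 1:] ^ 2 dvd p" by (simp add: order_divides)
    then obtain h where "p = [:-z, 1:] ^ 2 * h" by (elim dvdE)
    then have h: "p = [:-z, 1:] * ([:-z, 1:] * h)" by (simp only: power2_eq_square mult.assoc)
    then have "poly p z = 0" by simp
    then obtain l where l: "z = of_real l" using root by blast
    let ?T = "poly_op B A N [:-z, 1:]"
    have herm: "adj_op ?T = ?T"
      using adj_poly_op_real[OF Nin pos_def_hermitian[OF N], of "[:-l, 1:]"]
      by (simp add: map_poly_pCons l)
    have "poly_op B A N ([:-z, 1:] * ([:-z, 1:] * h)) = zero_op"
      using p(2) by (subst h[symmetric])
    then have "?T \<cdot> (?T \<cdot> poly_op B A N h) = zero_op"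
      unfolding poly_op_mult .
    then have "?T \<cdot> poly_op B A N h = zero_op"
      by (rule hermitian_square_cancel[OF poly_op_in herm])
    then show False using factor[OF h] unfolding poly_op_mult by (rule notE[rotated])
  qed
  then have sqf: "rsquarefree p"
    using p(1) unfolding rsquarefree_def by (metis One_nat_def le_SucE le_zero_eq)
  let ?Z = "{z. poly p z = 0}"
  have finZ: "finite ?Z" using p(1) by (rule poly_roots_finite)
  \<comment> \<open>Simplicity of the roots becomes a count: \<open>p\<close> has as many distinct
    roots as its degree.\<close>
  have "p = smult (lead_coeff p) (\<Prod>z\<in>?Z. [:-z, 1:])"
    using complex_poly_decompose_rsquarefree[OF sqf] by simp
  then have "degree p = degree (smult (lead_coeff p) (\<Prod>z\<in>?Z. [:-z, 1:]))" by (rule arg_cong)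
  also have "\<dots> = card ?Z" using p(1) by (simp add: degree_prod_sum_eq)
  finally have deg: "degree p = card ?Z" .
  show thesis
  proof (rule that[of "Re ` ?Z"])
    show "finite (Re ` ?Z)" using finZ by simp
    show "0 < l" if "l \<in> Re ` ?Z" for l using that root by force
    show "poly_op B A N q = poly_op B A N r"
      if eq: "\<And>l. l \<in> Re ` ?Z \<Longrightarrow> poly q (of_real l) = poly r (of_real l)" for q r
    proof -
      let ?d = "q - r"
      \<comment> \<open>The remainder modulo \<open>p\<close> vanishes at all
        \<open>degree p\<close> roots while having smaller degree, so it must be zero.\<close>
      have van: "poly (?d mod p) z = 0" if "z \<in> ?Z" for z
      proof -
        have "poly ?d z = 0" using that root[of z] eq[of "Re z"] by force
        moreover have "poly (?d mod p) z = poly ?d z - poly (?d div p) z * poly p z"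
          by (metis minus_div_mult_eq_mod poly_diff poly_mult)
        ultimately show ?thesis using that by simp
      qed
      have "?d mod p = 0"
      proof (rule ccontr)
        assume nz: "?d mod p \<noteq> 0"
        have "card ?Z \<le> card {z. poly (?d mod p) z = 0}"
          using van by (intro card_mono poly_roots_finite[OF nz]) auto
        also have "\<dots> \<le> degree (?d mod p)" by (rule card_poly_roots_bound[OF nz])
        also have "\<dots> < degree p" using degree_mod_less[OF p(1), of ?d] nz by simp
        finally show False using deg by simp
      qed
      then have "q = p * (?d div p) + r" by (metis add.right_neutral diff_add_cancel mult_div_mod_eq)
      then have "poly_op B A N q = poly_op B A N (p * (?d div p) + r)" by (rule arg_cong)
      then show ?thesis by (simp add: poly_op_add poly_op_mult p(2))
    qed
  qed
qed

section \<open>Inverses and square roots\<close>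

lemma pos_def_inverse_exists:
  assumes M: "pos_def B A M"
  obtains L where "L \<in> operators B A" "L \<cdot> M = id_op B A" "M \<cdot> L = id_op B A"
proof -
  obtain S where S: "finite S" "\<And>l. l \<in> S \<Longrightarrow> 0 < l"
    and eq: "\<And>p q. (\<And>l. l \<in> S \<Longrightarrow> poly p (of_real l) = poly q (of_real l))
      \<Longrightarrow> poly_op B A M p = poly_op B A M q"
    using spectrum_exists[OF M] by blast
  obtain q where q: "\<forall>l\<in>S. poly q l = inverse l"
    using interpolating_poly_exists[OF S(1), of inverse] by blast
  let ?P = "map_poly complex_of_real q"
  have "poly_op B A M (?P * [:0, 1:]) = poly_op B A M 1"
  proof (rule eq)
    fix l assume l: "l \<in> S"
    then have "l * poly q l = 1" using q S(2)[OF l] by simp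
    then show "poly (?P * [:0, 1:]) (of_real l) = poly 1 (of_real l)"
      by (simp add: poly_map_of_real flip: of_real_mult)
  qed
  then have 1: "poly_op B A M ?P \<cdot> M = id_op B A"
    using poly_op_X[OF pos_def_in[OF M]] by (simp only: poly_op_mult poly_op_1)
  have "poly_op B A M ([:0, 1:] * ?P) = poly_op B A M (?P * [:0, 1:])" by (simp only: mult.commute)
  then have "M \<cdot> poly_op B A M ?P = poly_op B A M ?P \<cdot> M"
    using poly_op_X[OF pos_def_in[OF M]] by (simp only: poly_op_mult)
  with 1 show thesis by (intro that[of "poly_op B A M ?P"]) simp_all
qed

text \<open>A fourth root \<open>?T\<close> is built first. It is Hermitian, and interpolated
  reciprocals invert it, so \<open>?T \<cdot> ?T\<close> is a Gram operator and its positivity comes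
  from \<open>pos_def_gram\<close>.\<close>

lemma pos_def_sqrt_exists:
  assumes N: "pos_def B A N"
  obtains R where "pos_def B A R" "R \<cdot> R = N"
proof -
  note Nin = pos_def_in[OF N]
  obtain S where S: "finite S" "\<And>l. l \<in> S \<Longrightarrow> 0 < l"
    and eq: "\<And>p q. (\<And>l. l \<in> S \<Longrightarrow> poly p (of_real l) = poly q (of_real l))
      \<Longrightarrow> poly_op B A N p = poly_op B A N q"
    using spectrum_exists[OF N] by blast
  obtain q where q: "\<forall>l\<in>S. poly q l = sqrt (sqrt l)"
    using interpolating_poly_exists[OF S(1), of "\<lambda>l. sqrt (sqrt l)"] by blast
  obtain s where s: "\<forall>l\<in>S. poly s l = inverse (sqrt (sqrt l))"
    using interpolating_poly_exists[OF S(1), of "\<lambda>l. inverse (sqrt (sqrt l))"] by blast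
  let ?P = "map_poly complex_of_real q" and ?S = "map_poly complex_of_real s"
  let ?T = "poly_op B A N ?P"
  have herm: "adj_op ?T = ?T"
    by (rule adj_poly_op_real[OF Nin pos_def_hermitian[OF N]])
  have "poly_op B A N (?S * ?P) = poly_op B A N 1"
  proof (rule eq)
    fix l assume l: "l \<in> S"
    then have "poly s l * poly q l = 1" using q s S(2)[OF l] by simp
    then show "poly (?S * ?P) (of_real l) = poly 1 (of_real l)"
      by (simp add: poly_map_of_real flip: of_real_mult)
  qed
  then have inv: "poly_op B A N ?S \<cdot> ?T = id_op B A"
    by (simp only: poly_op_mult poly_op_1)
  have "poly_op B A N (?P * ?P * (?P * ?P)) = poly_op B A N [:0, 1:]"
  proof (rule eq)
    fix l assume l: "l \<in> S"
    then have "poly q l * poly q l * (poly q l * poly q l) = l" using q S(2)[OF l] by simp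
    then show "poly (?P * ?P * (?P * ?P)) (of_real l) = poly [:0, 1:] (of_real l)"
      by (simp add: poly_map_of_real flip: of_real_mult)
  qed
  then have "?T \<cdot> ?T \<cdot> (?T \<cdot> ?T) = N"
    by (simp only: poly_op_mult poly_op_X[OF Nin])
  moreover have "pos_def B A (?T \<cdot> ?T)"
    using pos_def_gram[OF poly_op_in inv] unfolding herm .
  ultimately show thesis using that by blast
qed

lemma trace_commute: "(\<Sum>x\<in>cfg B A. (M \<cdot> N) x x) = (\<Sum>x\<in>cfg B A. (N \<cdot> M) x x)"
  by (simp add: mult_op_def mult.commute) (rule sum.swap)

text \<open>With \<open>D = R - R'\<close> one has \<open>D R + R' D = 0\<close>, hence \<open>tr (D R D) + tr (D R' D) = 0\<close>, a sum of
  two nonnegative terms.\<close>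

lemma pos_def_sqrt_unique:
  assumes R: "pos_def B A R" and R': "pos_def B A R'" and eq: "R \<cdot> R = R' \<cdot> R'"
  shows "R = R'"
proof -
  define D where "D = add_op R (scale_op (-1) R')"
  have D: "adj_op D = D"
    using pos_def_hermitian[OF R] pos_def_hermitian[OF R'] by (simp add: D_def)
  \<comment> \<open>The expansion is \<open>R R - R' R + R' R - R' R'\<close>, where the middle
    terms cancel and the outer ones cancel by \<open>eq\<close>.\<close>
  have "add_op (D \<cdot> R) (R' \<cdot> D) = zero_op"
    by (simp add: D_def eq) (simp add: fun_eq_iff add_op_def scale_op_def zero_op_def)
  then have "D \<cdot> add_op (D \<cdot> R) (R' \<cdot> D) = zero_op" by simp
  then have "add_op (D \<cdot> (D \<cdot> R)) (D \<cdot> R' \<cdot> D) = zero_op" by (simp add: mult_op_assoc)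
  then have "(D \<cdot> (D \<cdot> R)) x x + (D \<cdot> R' \<cdot> D) x x = 0" for x
    by (simp add: fun_eq_iff add_op_def zero_op_def)
  then have "(\<Sum>x\<in>cfg B A. (D \<cdot> (D \<cdot> R)) x x) + (\<Sum>x\<in>cfg B A. (D \<cdot> R' \<cdot> D) x x) = 0"
    by (simp flip: sum.distrib)
  \<comment> \<open>Cyclicity of the trace turns \<open>D D R\<close> into
    \<open>D R D\<close>.\<close>
  then have "(\<Sum>x\<in>cfg B A. (D \<cdot> R \<cdot> D) x x + (D \<cdot> R' \<cdot> D) x x) = 0"
    by (simp add: trace_commute[of D "D \<cdot> R"] sum.distrib)
  then have sum0: "(\<Sum>x\<in>cfg B A. Re ((D \<cdot> R \<cdot> D) x x) + Re ((D \<cdot> R' \<cdot> D) x x)) = 0"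
    by (metis (no_types, lifting) Re_sum plus_complex.sel(1) sum.cong zero_complex.sel(1))
  note nn = pos_def_conj_entry(2)[OF R, of _ D, unfolded D]
    pos_def_conj_entry(2)[OF R', of _ D, unfolded D]
  have "Re ((D \<cdot> R \<cdot> D) x x) = 0" if x: "x \<in> cfg B A" for x
  proof -
    have "Re ((D \<cdot> R \<cdot> D) x x) + Re ((D \<cdot> R' \<cdot> D) x x) = 0"
      using sum0 x nn by (subst (asm) sum_nonneg_eq_0_iff[OF fin]) auto
    then show ?thesis using nn[OF x] by linarith
  qed
  \<comment> \<open>The positive definite form of \<open>R\<close> vanishes at each column of
    \<open>D\<close>, so the columns are zero.\<close>
  then have "D y x = 0" if "y \<in> cfg B A" "x \<in> cfg B A" for y x
    using pos_def_conj_entry(3)[OF R that(2), of D, unfolded D] that by blast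
  then show ?thesis
    by (intro operators_eqI[OF pos_def_in[OF R] pos_def_in[OF R']])
      (simp add: D_def add_op_def scale_op_def)
qed

text \<open>Uniqueness makes the definite description usable: to compute a square root it suffices
  to exhibit one.\<close>

lemma sqrt_op_eqI:
  assumes "pos_def B A R" "R \<cdot> R = N"
  shows "sqrt_op B A N = R"
  unfolding sqrt_op_def using assms pos_def_sqrt_unique by (intro the_equality) auto

lemma sqrt_op:
  assumes "pos_def B A N"
  shows "pos_def B A (sqrt_op B A N)" "sqrt_op B A N \<cdot> sqrt_op B A N = N"
  using pos_def_sqrt_exists[OF assms] sqrt_op_eqI by metis+

lemma inv_op_eqI:
  assumes "L \<in> operators B A" "L \<cdot> M = id_op B A" "M \<cdot> L = id_op B A"
  shows "inv_op B A M = L"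
  unfolding inv_op_def
proof (rule the_equality)
  show "K = L" if "K \<in> operators B A \<and> K \<cdot> M = id_op B A \<and> M \<cdot> K = id_op B A" for K
    using that assms by (metis mult_op_assoc mult_op_id)
qed (use assms in simp)

lemma inv_op:
  assumes "pos_def B A M"
  shows "inv_op B A M \<in> operators B A" "inv_op B A M \<cdot> M = id_op B A" "M \<cdot> inv_op B A M = id_op B A"
  using pos_def_inverse_exists[OF assms] inv_op_eqI by metis+

text \<open>With \<open>R\<close> and \<open>S\<close> the square roots of \<open>N\<close> and
  \<open>M\<close>, the product \<open>R M R\<close> is the Gram operator of the invertible
  \<open>S R\<close>.\<close>

lemma pos_def_star:
  assumes M: "pos_def B A M" and N: "pos_def B A N"
  shows "pos_def B A (star_op B A M N)"
proof -
  let ?R = "sqrt_op B A N" and ?S = "sqrt_op B A M"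
  note R = sqrt_op[OF N] and S = sqrt_op[OF M]
  have "(inv_op B A ?R \<cdot> inv_op B A ?S) \<cdot> (?S \<cdot> ?R) = inv_op B A ?R \<cdot> (inv_op B A ?S \<cdot> ?S) \<cdot> ?R"
    by (simp only: mult_op_assoc)
  also have "\<dots> = id_op B A"
    using inv_op[OF R(1)] inv_op[OF S(1)] by simp
  finally have "pos_def B A (adj_op (?S \<cdot> ?R) \<cdot> (?S \<cdot> ?R))"
    by (intro pos_def_gram) simp_all
  also have "adj_op (?S \<cdot> ?R) \<cdot> (?S \<cdot> ?R) = ?R \<cdot> (?S \<cdot> ?S) \<cdot> ?R"
    by (simp add: mult_op_assoc pos_def_hermitian[OF R(1)] pos_def_hermitian[OF S(1)])
  finally show ?thesis by (simp add: star_op_def S(2))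
qed

end

subsection \<open>Embeddings and partial traces\<close>

lemma finite_cfg: "finite A \<Longrightarrow> (\<And>v. v \<in> A \<Longrightarrow> finite (B v)) \<Longrightarrow> finite (cfg B A)"
  unfolding cfg_def by (rule finite_PiE)


lemma restrict_cfg: "x \<in> cfg B S \<Longrightarrow> A \<subseteq> S \<Longrightarrow> restrict x A \<in> cfg B A"
  unfolding cfg_def by auto

lemma override_cfg:
  "x \<in> cfg B S \<Longrightarrow> w \<in> cfg B A \<Longrightarrow> A \<subseteq> S \<Longrightarrow> override_on x w A \<in> cfg B S"
  unfolding cfg_def by (auto simp: override_on_def PiE_iff extensional_def)

text \<open>\<open>override_on z x (S - C)\<close> glues a label \<open>z\<close> on
  \<open>C\<close> to a label \<open>x\<close> on the rest; these are the labels in the sum of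
  \<open>ptrace\<close>.\<close>

lemma override_cfg_diff:
  "z \<in> cfg B C \<Longrightarrow> x \<in> cfg B (S - C) \<Longrightarrow> C \<subseteq> S \<Longrightarrow> override_on z x (S - C) \<in> cfg B S"
  unfolding cfg_def by (auto simp: override_on_def PiE_iff extensional_def)

lemma restrict_override [simp]: "w \<in> cfg B A \<Longrightarrow> restrict (override_on x w A) A = w"
  by (auto simp: fun_eq_iff override_on_def cfg_def PiE_iff extensional_def)

lemma override_override [simp]: "override_on (override_on z x A) w A = override_on z w A"
  by (auto simp: fun_eq_iff override_on_def)

lemma embed_op_in [simp]: "embed_op B A S M \<in> operators B S"
  by (simp add: operators_def embed_op_def)

lemma adj_embed: "adj_op (embed_op B A S M) = embed_op B A S (adj_op M)"
  by (auto simp: adj_op_def embed_op_def fun_eq_iff)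

lemma embed_id:
  assumes "A \<subseteq> S"
  shows "embed_op B A S (id_op B A) = id_op B S"
proof (rule operators_eqI[OF embed_op_in id_op_in])
  fix x y assume xy: "x \<in> cfg B S" "y \<in> cfg B S"
  have "x = y \<longleftrightarrow> (\<forall>v\<in>S - A. x v = y v) \<and> restrict x A = restrict y A"
    using xy unfolding cfg_def
    by (auto simp: fun_eq_iff PiE_iff extensional_def restrict_def) (metis DiffI)
  then show "embed_op B A S (id_op B A) x y = id_op B S x y"
    using xy restrict_cfg[OF _ assms] by (auto simp: embed_op_def id_op_def)
qed

text \<open>Row \<open>x\<close> of the embedded operator is supported on labels agreeing with
  \<open>x\<close> off \<open>A\<close>, and these are parametrised by their restriction
  \<open>w\<close> to \<open>A\<close>.\<close>

lemma sum_embed_left: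
  assumes fin: "finite (cfg B S)" and A: "A \<subseteq> S" and x: "x \<in> cfg B S"
  shows "(\<Sum>y\<in>cfg B S. embed_op B A S M x y * f y)
    = (\<Sum>w\<in>cfg B A. M (restrict x A) w * f (override_on x w A))"
proof -
  let ?g = "\<lambda>w. override_on x w A"
  have inj: "inj_on ?g (cfg B A)"
    by (rule inj_on_inverseI[of _ "\<lambda>y. restrict y A"]) simp
  have "(\<Sum>w\<in>cfg B A. M (restrict x A) w * f (?g w))
      = (\<Sum>w\<in>cfg B A. embed_op B A S M x (?g w) * f (?g w))"
    using x override_cfg[OF x _ A] by (intro sum.cong) (auto simp: embed_op_def)
  also have "\<dots> = (\<Sum>y\<in>?g ` cfg B A. embed_op B A S M x y * f y)"
    by (simp add: sum.reindex[OF inj])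
  also have "\<dots> = (\<Sum>y\<in>cfg B S. embed_op B A S M x y * f y)"
  proof (rule sum.mono_neutral_left[OF fin], use override_cfg[OF x _ A] in blast, rule ballI)
    fix y assume y: "y \<in> cfg B S - ?g ` cfg B A"
    have "\<not> (\<forall>v\<in>S - A. x v = y v)"
    proof
      assume "\<forall>v\<in>S - A. x v = y v"
      then have "y = ?g (restrict y A)"
        using x y A by (auto simp: fun_eq_iff override_on_def cfg_def PiE_iff extensional_def)
          (metis DiffI)
      then show False using y restrict_cfg[OF _ A, of y B] by blast
    qed
    then show "embed_op B A S M x y * f y = 0" by (auto simp: embed_op_def)
  qed
  finally show ?thesis ..
qed

text \<open>Embedding commutes with transposition (without conjugation), which reduces columns to
  rows.\<close>

lemma sum_embed_right:
  assumes "finite (cfg B S)" "A \<subseteq> S" "x \<in> cfg B S"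
  shows "(\<Sum>y\<in>cfg B S. f y * embed_op B A S M y x)
    = (\<Sum>w\<in>cfg B A. f (override_on x w A) * M w (restrict x A))"
proof -
  have "embed_op B A S M y x = embed_op B A S (\<lambda>a b. M b a) x y" for y
    by (auto simp: embed_op_def)
  then show ?thesis
    using sum_embed_left[OF assms, of "\<lambda>a b. M b a" f] by (simp add: mult.commute)
qed

lemma embed_mult:
  assumes fin: "finite (cfg B S)" and A: "A \<subseteq> S"
  shows "mult_op B S (embed_op B A S M) (embed_op B A S N) = embed_op B A S (mult_op B A M N)"
proof (rule operators_eqI[OF mult_op_in embed_op_in])
  fix x z assume xz: "x \<in> cfg B S" "z \<in> cfg B S"
  \<comment> \<open>Overriding \<open>x\<close> on \<open>A\<close> leaves it unchanged on
    \<open>S - A\<close>, so the condition in the embedding does not depend on the summation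
    label.\<close>
  define c where "c \<longleftrightarrow> (\<forall>v\<in>S - A. x v = z v)"
  have "embed_op B A S N (override_on x w A) z = (if c then N w (restrict z A) else 0)"
    if "w \<in> cfg B A" for w
    using that xz override_cfg[OF xz(1) that A] by (auto simp: embed_op_def c_def)
  then have "mult_op B S (embed_op B A S M) (embed_op B A S N) x z
      = (\<Sum>w\<in>cfg B A. M (restrict x A) w * (if c then N w (restrict z A) else 0))"
    using xz by (simp add: mult_op_def sum_embed_left[OF fin A] cong: sum.cong)
  also have "\<dots> = embed_op B A S (mult_op B A M N) x z"
    using xz by (simp add: restrict_cfg[OF _ A] embed_op_def mult_op_def flip: c_def)
  finally show "mult_op B S (embed_op B A S M) (embed_op B A S N) x z
      = embed_op B A S (mult_op B A M N) x z" .
qed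

section \<open>Partial traces\<close>

lemma ptrace_in [simp]: "ptrace B S C M \<in> operators B (S - C)"
  by (simp add: operators_def ptrace_def)

lemma ptrace_empty:
  assumes "M \<in> operators B S"
  shows "ptrace B S {} M = M"
proof -
  \<comment> \<open>The sum over \<open>cfg B {}\<close> has a single term, for the constantly
    \<open>undefined\<close> label.\<close>
  have "override_on (\<lambda>_. undefined) x S = x" if "x \<in> cfg B S" for x
    using that by (auto simp: fun_eq_iff override_on_def cfg_def PiE_iff extensional_def)
  then show ?thesis
    using assms ptrace_in[of B S "{}"]
    by (intro operators_eqI[of _ B S]) (auto simp: ptrace_def cfg_def)
qed

text \<open>As \<open>C\<close> and \<open>D\<close> are disjoint, labels on their union correspond
  to pairs \<open>(d, c)\<close>, pasted together by \<open>override_on c d D\<close>.\<close>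

lemma ptrace_ptrace:
  assumes "C \<subseteq> S" "D \<subseteq> S" "C \<inter> D = {}"
  shows "ptrace B (S - C) D (ptrace B S C M) = ptrace B S (C \<union> D) M"
proof -
  have S: "S - C - D = S - (C \<union> D)" by blast
  have "ptrace B S (C \<union> D) M \<in> operators B (S - C - D)" unfolding S by (rule ptrace_in)
  then show ?thesis
  proof (rule operators_eqI[OF ptrace_in])
    fix x y assume xy: "x \<in> cfg B (S - C - D)" "y \<in> cfg B (S - C - D)"
    let ?o = "\<lambda>c d x. override_on c (override_on d x (S - C - D)) (S - C)"
    have D: "D \<subseteq> S - C" using assms by blast
    have "ptrace B (S - C) D (ptrace B S C M) x y
        = (\<Sum>d\<in>cfg B D. \<Sum>c\<in>cfg B C. M (?o c d x) (?o c d y))"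
      using xy by (simp add: override_cfg_diff[OF _ _ D] ptrace_def cong: sum.cong)
    also have "\<dots> = (\<Sum>(d, c)\<in>cfg B D \<times> cfg B C. M (?o c d x) (?o c d y))"
      by (rule sum.cartesian_product)
    also have "\<dots> = (\<Sum>z\<in>cfg B (C \<union> D).
        M (override_on z x (S - (C \<union> D))) (override_on z y (S - (C \<union> D))))"
    proof (rule sum.reindex_bij_witness[where i = "\<lambda>z. (restrict z D, restrict z C)"
          and j = "\<lambda>(d, c). override_on c d D"])
      fix a assume a: "a \<in> cfg B D \<times> cfg B C"
      obtain d c where dc: "a = (d, c)" "d \<in> cfg B D" "c \<in> cfg B C" using a by auto
      have "restrict (override_on c d D) C = c"
        using dc assms by (auto simp: fun_eq_iff override_on_def cfg_def PiE_iff extensional_def)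
      with dc show "(restrict (case a of (d, c) \<Rightarrow> override_on c d D) D,
          restrict (case a of (d, c) \<Rightarrow> override_on c d D) C) = a" by simp
      show "(case a of (d, c) \<Rightarrow> override_on c d D) \<in> cfg B (C \<union> D)"
        using dc unfolding cfg_def by (auto simp: override_on_def PiE_iff extensional_def)
      have "override_on (override_on c d D) w (S - (C \<union> D)) = ?o c d w"
        if "w \<in> cfg B (S - C - D)" for w
        using dc assms that
        by (auto simp: fun_eq_iff override_on_def cfg_def PiE_iff extensional_def)
      then show "M (override_on (case a of (d, c) \<Rightarrow> override_on c d D) x (S - (C \<union> D)))
          (override_on (case a of (d, c) \<Rightarrow> override_on c d D) y (S - (C \<union> D)))
          = (case a of (d, c) \<Rightarrow> M (?o c d x) (?o c d y))"
        using dc xy by simp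
    next
      fix z assume z: "z \<in> cfg B (C \<union> D)"
      show "(case (restrict z D, restrict z C) of (d, c) \<Rightarrow> override_on c d D) = z"
        using z by (auto simp: fun_eq_iff override_on_def cfg_def PiE_iff extensional_def)
      show "(restrict z D, restrict z C) \<in> cfg B D \<times> cfg B C"
        using z restrict_cfg[of z B "C \<union> D"] by auto
    qed
    also have "\<dots> = ptrace B S (C \<union> D) M x y"
      using xy by (simp add: ptrace_def S)
    finally show "ptrace B (S - C) D (ptrace B S C M) x y = ptrace B S (C \<union> D) M x y" .
  qed
qed

text \<open>The traced factors lie in \<open>A\<close>, so the identity on \<open>S - A\<close> is
  untouched.\<close>

lemma ptrace_embed:
  assumes "C \<subseteq> A" "A \<subseteq> S"
  shows "ptrace B S C (embed_op B A S M) = embed_op B (A - C) (S - C) (ptrace B A C M)"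
proof (rule operators_eqI[OF ptrace_in embed_op_in])
  fix x y assume xy: "x \<in> cfg B (S - C)" "y \<in> cfg B (S - C)"
  have CS: "C \<subseteq> S" and D: "S - C - (A - C) = S - A" using assms by auto
  have r: "restrict (override_on z w (S - C)) A = override_on z (restrict w (A - C)) (A - C)"
    if "z \<in> cfg B C" for z w :: "'a \<Rightarrow> 'b"
    using that assms by (auto simp: fun_eq_iff override_on_def cfg_def PiE_iff extensional_def)
  define c where "c \<longleftrightarrow> (\<forall>v\<in>S - A. x v = y v)"
  have e: "embed_op B A S M (override_on z x (S - C)) (override_on z y (S - C))
      = (if c then M (override_on z (restrict x (A - C)) (A - C))
          (override_on z (restrict y (A - C)) (A - C)) else 0)" if z: "z \<in> cfg B C" for z
  proof -
    have "(\<forall>v\<in>S - A. override_on z x (S - C) v = override_on z y (S - C) v) \<longleftrightarrow> c"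
      using assms unfolding c_def by (intro ball_cong) (auto simp: override_on_def)
    then show ?thesis
      using override_cfg_diff[OF z _ CS] xy by (simp add: embed_op_def r[OF z])
  qed
  have "restrict w (A - C) \<in> cfg B (A - C)" if "w \<in> cfg B (S - C)" for w
    using that assms by (intro restrict_cfg[of w B "S - C"]) auto
  then show "ptrace B S C (embed_op B A S M) x y
      = embed_op B (A - C) (S - C) (ptrace B A C M) x y"
    using xy by (simp add: ptrace_def e embed_op_def[of B "A - C"] D flip: c_def cong: sum.cong)
qed

text \<open>The left factor acts trivially on \<open>C\<close>, so only the order of two sums has to
  be exchanged to pull it out.\<close>

lemma ptrace_mult_embed_left:
  assumes fin: "finite (cfg B S)" and C: "C \<subseteq> S"
  shows "ptrace B S C (mult_op B S (embed_op B (S - C) S R) M)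
    = mult_op B (S - C) R (ptrace B S C M)"
proof (rule operators_eqI[OF ptrace_in mult_op_in])
  fix x y assume xy: "x \<in> cfg B (S - C)" "y \<in> cfg B (S - C)"
  have "ptrace B S C (mult_op B S (embed_op B (S - C) S R) M) x y
      = (\<Sum>z\<in>cfg B C. \<Sum>w\<in>cfg B (S - C).
          R x w * M (override_on z w (S - C)) (override_on z y (S - C)))"
    using xy by (simp add: override_cfg_diff[OF _ _ C] ptrace_def mult_op_def sum_embed_left[OF fin Diff_subset]
        cong: sum.cong)
  also have "\<dots> = mult_op B (S - C) R (ptrace B S C M) x y"
    using xy by (subst sum.swap) (simp add: mult_op_def ptrace_def sum_distrib_left)
  finally show "ptrace B S C (mult_op B S (embed_op B (S - C) S R) M) x y
      = mult_op B (S - C) R (ptrace B S C M) x y" .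
qed

lemma ptrace_mult_embed_right:
  assumes fin: "finite (cfg B S)" and C: "C \<subseteq> S"
  shows "ptrace B S C (mult_op B S M (embed_op B (S - C) S R))
    = mult_op B (S - C) (ptrace B S C M) R"
proof (rule operators_eqI[OF ptrace_in mult_op_in])
  fix x y assume xy: "x \<in> cfg B (S - C)" "y \<in> cfg B (S - C)"
  have "ptrace B S C (mult_op B S M (embed_op B (S - C) S R)) x y
      = (\<Sum>z\<in>cfg B C. \<Sum>w\<in>cfg B (S - C).
          M (override_on z x (S - C)) (override_on z w (S - C)) * R w y)"
    using xy by (simp add: override_cfg_diff[OF _ _ C] ptrace_def mult_op_def sum_embed_right[OF fin Diff_subset]
        cong: sum.cong)
  also have "\<dots> = mult_op B (S - C) (ptrace B S C M) R x y"
    using xy by (subst sum.swap) (simp add: mult_op_def ptrace_def sum_distrib_right)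
  finally show "ptrace B S C (mult_op B S M (embed_op B (S - C) S R)) x y
      = mult_op B (S - C) (ptrace B S C M) R x y" .
qed

section \<open>Square roots and the star product under embedding\<close>

lemma pos_def_embed:
  assumes finS: "finite (cfg B S)" and finA: "finite (cfg B A)" and A: "A \<subseteq> S"
    and M: "pos_def B A M"
  shows "pos_def B S (embed_op B A S M)"
proof -
  note R = sqrt_op[OF finA M]
  let ?T = "embed_op B A S (sqrt_op B A M)"
  \<comment> \<open>The embedded root is inverted by the embedded inverse root, so its Gram
    operator, the embedding of \<open>M\<close>, is positive definite.\<close>
  have "mult_op B S (embed_op B A S (inv_op B A (sqrt_op B A M))) ?T = id_op B S"
    by (simp add: embed_mult[OF finS A] inv_op[OF finA R(1)] embed_id[OF A])
  from pos_def_gram[OF finS embed_op_in this] show ?thesis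
    by (simp add: adj_embed pos_def_hermitian[OF finA R(1)] embed_mult[OF finS A] R(2))
qed

text \<open>By uniqueness of the root. This is what lets the root leave a partial trace and be
  cancelled by an embedded inverse.\<close>

lemma sqrt_embed:
  assumes finS: "finite (cfg B S)" and finA: "finite (cfg B A)" and A: "A \<subseteq> S"
    and M: "pos_def B A M"
  shows "sqrt_op B S (embed_op B A S M) = embed_op B A S (sqrt_op B A M)"
  using sqrt_op[OF finA M]
  by (intro sqrt_op_eqI[OF finS] pos_def_embed[OF finS finA A]) (simp_all add: embed_mult[OF finS A])

text \<open>Both outer roots leave the trace, and the identity remains between them.\<close>

lemma ptrace_star_embed:
  assumes finS: "finite (cfg B S)" and finC: "finite (cfg B (S - C))" and C: "C \<subseteq> S"
    and N: "pos_def B (S - C) N" and M: "ptrace B S C M = id_op B (S - C)"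
  shows "ptrace B S C (star_op B S M (embed_op B (S - C) S N)) = N"
  using sqrt_op[OF finC N]
  by (simp add: star_op_def sqrt_embed[OF finS finC Diff_subset N] ptrace_mult_embed_left[OF finS C]
      ptrace_mult_embed_right[OF finS C] M mult_op_id[OF finC] pos_def_in[OF finC])

text \<open>\<open>K\<close> has the form of the outer factor in \<open>conditional\<close>; it
  inverts the embedded root on both sides and so undoes the star product.\<close>

lemma unstar_embed:
  assumes finS: "finite (cfg B S)" and finA: "finite (cfg B A)" and A: "A \<subseteq> S"
    and N: "pos_def B A N" and M: "M \<in> operators B S"
    and K: "K = embed_op B A S (inv_op B A (sqrt_op B A N))"
  shows "mult_op B S (mult_op B S K (star_op B S M (embed_op B A S N))) K = M"
proof -
  note R = sqrt_op[OF finA N]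
  let ?R = "embed_op B A S (sqrt_op B A N)"
  have KR: "mult_op B S K ?R = id_op B S" "mult_op B S ?R K = id_op B S"
    by (simp_all add: K embed_mult[OF finS A] inv_op[OF finA R(1)] embed_id[OF A])
  have "mult_op B S (mult_op B S K (star_op B S M (embed_op B A S N))) K
      = mult_op B S (mult_op B S (mult_op B S K ?R) M) (mult_op B S ?R K)"
    by (simp only: star_op_def sqrt_embed[OF finS finA A N] mult_op_assoc[OF finS])
  then show ?thesis by (simp add: KR M mult_op_id[OF finS])
qed

subsection \<open>The ordered kernel construction\<close>

lemma prefix_set_Suc: "prefix_set vs (Suc j) = insert (vs (Suc j)) (prefix_set vs j)"
  by (simp add: prefix_set_def atLeastAtMostSuc_conv)

theorem corollary4p2:
  fixes V :: "'v set" and E :: "('v \<times> 'v) set"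
    and B :: "'v \<Rightarrow> 'b set" and Q :: "'v \<Rightarrow> ('v, 'b) oper"
    and n :: nat and vs :: "nat \<Rightarrow> 'v" and \<omega> :: "('v, 'b) oper"
  assumes "dag V E"
    and "\<And>v. v \<in> V \<Longrightarrow> finite (B v)"
    and "topological_ordering V E n vs"
    and "quantum_kernels B V E Q"
    and "\<omega> = ordered_construction B E n vs Q"
  shows "\<forall>j\<in>{2..n}. conditional B V \<omega> {vs j} (prefix_set vs (j - 1))
           = embed_op B ({vs j} \<union> parents E (vs j)) (prefix_set vs j) (Q (vs j))"
proof -
  let ?P = "prefix_set vs" and ?w = "kernel_state B E vs Q"
  have finV: "finite V" and EV: "E \<subseteq> V \<times> V" using assms(1) by (auto simp: dag_def)
  have bij: "bij_betw vs {1..n} V"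
    and topo: "\<And>i j. i \<in> {1..n} \<Longrightarrow> j \<in> {1..n} \<Longrightarrow> (vs i, vs j) \<in> E \<Longrightarrow> i < j"
    using assms(3) by (auto simp: topological_ordering_def)
  have Pn: "?P n = V" using bij by (simp add: prefix_set_def bij_betw_def)
  have PV: "?P j \<subseteq> V" if "j \<le> n" for j
    using that unfolding Pn[symmetric] prefix_set_def by auto
  have vV: "vs j \<in> V" if "j \<in> {1..n}" for j
    using that bij by (auto simp: bij_betw_def)
  have new: "vs (Suc j) \<notin> ?P j" if "Suc j \<le> n" for j
  proof
    assume "vs (Suc j) \<in> ?P j"
    then obtain i where "i \<in> {1..j}" "vs (Suc j) = vs i" by (auto simp: prefix_set_def)
    then show False using inj_onD[OF bij_betw_imp_inj_on[OF bij], of "Suc j" i] that by auto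
  qed
  \<comment> \<open>Arrows increase the index, so each kernel embeds into the prefix that ends with
    its vertex.\<close>
  have par: "parents E (vs (Suc j)) \<subseteq> ?P j" if "Suc j \<le> n" for j
  proof
    fix u assume "u \<in> parents E (vs (Suc j))"
    then have e: "(u, vs (Suc j)) \<in> E" by (simp add: parents_def)
    then obtain i where i: "i \<in> {1..n}" "u = vs i" using EV bij by (auto simp: bij_betw_def)
    then show "u \<in> ?P j" using topo[of i "Suc j"] e that by (auto simp: prefix_set_def)
  qed
  have fin: "finite (cfg B A)" if "A \<subseteq> V" for A
    using that finV assms(2) by (intro finite_cfg) (auto intro: finite_subset)
  let ?K = "\<lambda>j. embed_op B ({vs j} \<union> parents E (vs j)) (?P j) (Q (vs j))"
  have kernel: "pos_def B (?P (Suc j)) (?K (Suc j))"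
    "ptrace B (?P (Suc j)) {vs (Suc j)} (?K (Suc j)) = id_op B (?P j)"
    if j: "Suc j \<le> n" for j
  proof -
    let ?v = "vs (Suc j)"
    have sub: "{?v} \<union> parents E ?v \<subseteq> ?P (Suc j)" using par[OF j] by (auto simp: prefix_set_Suc)
    have Q: "pos_def B ({?v} \<union> parents E ?v) (Q ?v)"
      "ptrace B ({?v} \<union> parents E ?v) {?v} (Q ?v) = id_op B (parents E ?v)"
      using assms(4) vV[of "Suc j"] j by (auto simp: quantum_kernels_def)
    show "pos_def B (?P (Suc j)) (?K (Suc j))"
      using sub PV[OF j] by (intro pos_def_embed fin Q) auto
    \<comment> \<open>The traced vertex is neither among its parents nor in the earlier prefix, so
      the kernel's trace condition passes through the embedding.\<close>
    have "({?v} \<union> parents E ?v) - {?v} = parents E ?v" "?P (Suc j) - {?v} = ?P j"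
      using par[OF j] new[OF j] by (auto simp: prefix_set_Suc)
    then show "ptrace B (?P (Suc j)) {?v} (?K (Suc j)) = id_op B (?P j)"
      using ptrace_embed[OF _ sub, of "{?v}" B "Q ?v"] Q(2) embed_id[OF par[OF j]] by simp
  qed
  have step: "?w (Suc (Suc j)) = star_op B (?P (Suc (Suc j))) (?K (Suc (Suc j)))
      (embed_op B (?P (Suc j)) (?P (Suc (Suc j))) (?w (Suc j)))" for j
    by (simp add: Let_def)
  have state: "pos_def B (?P (Suc j)) (?w (Suc j))" if "Suc j \<le> n" for j
    using that
  proof (induction j)
    case 0
    \<comment> \<open>The parents of the first vertex lie in the empty prefix, so its kernel is
      already an operator on the first prefix.\<close>
    have "parents E (vs 1) = {}" using par[of 0] 0 by (simp add: prefix_set_def)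
    then show ?case
      using assms(4) vV[of 1] 0 by (auto simp: quantum_kernels_def prefix_set_def)
  next
    case (Suc j)
    then show ?case unfolding step
      by (intro pos_def_star fin PV kernel pos_def_embed) (auto simp: prefix_set_Suc)
  qed
  have trace: "ptrace B (?P (Suc (Suc j))) {vs (Suc (Suc j))} (?w (Suc (Suc j))) = ?w (Suc j)"
    if j: "Suc (Suc j) \<le> n" for j
  proof -
    have P: "?P (Suc (Suc j)) - {vs (Suc (Suc j))} = ?P (Suc j)"
      using new[OF j] by (auto simp: prefix_set_Suc[of _ "Suc j"])
    have "{vs (Suc (Suc j))} \<subseteq> ?P (Suc (Suc j))" by (simp add: prefix_set_Suc)
    then show ?thesis
      unfolding step
      by (rule ptrace_star_embed[of B "?P (Suc (Suc j))" "{vs (Suc (Suc j))}", unfolded P, rotated 2])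
        (use j in \<open>auto intro!: fin PV state kernel(2)[simplified]\<close>)
  qed
  \<comment> \<open>Downward induction from \<open>n\<close>: the later vertices are traced out one
    at a time, the last one first.\<close>
  have marg: "marginal B V \<omega> (?P (Suc j)) = ?w (Suc j)" if "Suc j \<le> n" for j
  proof -
    obtain m where n: "n = Suc m" using \<open>Suc j \<le> n\<close> by (cases n) auto
    have "j \<le> m" using that n by simp
    then show ?thesis
    proof (induction rule: inc_induct)
      case base
      show ?case
        using Pn state[of m] n assms(5) pos_def_in[OF fin[OF order_refl]]
        by (simp add: marginal_def ordered_construction_def ptrace_empty)
    next
      case (step k)
      then have k: "Suc (Suc k) \<le> n" using n by simp
      \<comment> \<open>Tracing out the complement of the shorter prefix means tracing out that of
        the longer one and then the one vertex between them.\<close>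
      have "V - ?P (Suc k) = (V - ?P (Suc (Suc k))) \<union> {vs (Suc (Suc k))}"
        using new[OF k] PV[OF k] by (auto simp: prefix_set_Suc[of _ "Suc k"])
      moreover have "V - (V - ?P (Suc (Suc k))) = ?P (Suc (Suc k))"
        using PV[OF k] by blast
      ultimately have "marginal B V \<omega> (?P (Suc k))
          = ptrace B (?P (Suc (Suc k))) {vs (Suc (Suc k))} (marginal B V \<omega> (?P (Suc (Suc k))))"
        using ptrace_ptrace[of "V - ?P (Suc (Suc k))" V "{vs (Suc (Suc k))}" B \<omega>] vV[of "Suc (Suc k)"] k
        by (auto simp: marginal_def prefix_set_Suc[of _ "Suc k"])
      then show ?case using step.IH trace[OF k] by simp
    qed
  qed
  show ?thesis
  proof
    fix j assume "j \<in> {2..n}"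
    then obtain i where j: "j = Suc (Suc i)" and i: "Suc (Suc i) \<le> n"
      by (metis One_nat_def Suc_1 Suc_le_D Suc_le_mono atLeastAtMost_iff)
    \<comment> \<open>Here \<open>j = i + 2\<close>, so the prefix before \<open>vs j\<close>
      carries the state \<open>?w (Suc i)\<close>.\<close>
    have un: "{vs j} \<union> ?P (Suc i) = ?P j" by (simp add: j prefix_set_Suc[of _ "Suc i"])
    have sub: "?P (Suc i) \<subseteq> ?P j" using un by blast
    have "?w j = star_op B (?P j) (?K j) (embed_op B (?P (Suc i)) (?P j) (?w (Suc i)))"
      unfolding j by (rule step)
    \<comment> \<open>\<open>marg\<close> replaces the two marginals of the final state by the
      states at stages \<open>j - 1\<close> and \<open>j\<close>, which brings the conditional into
      the form treated by \<open>unstar_embed\<close>.\<close>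
    then show "conditional B V \<omega> {vs j} (?P (j - 1)) = ?K j"
      using unstar_embed[OF fin fin sub state embed_op_in refl] PV i marg[of i] marg[of "Suc i"] un
      by (simp add: conditional_def Let_def j del: kernel_state.simps)
  qed
qed

end
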